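(* For $a,b>0$ let $$g_{a,b}(y)=\frac{\Gamma(y+a)\,\Gamma(y+b)}{\Gamma(y)\,\Gamma(y+a+b)}=g_{b,a}(y),\qquad y>0.$$ Let $a\ge 1$ be an integer and let $b>a-1$ be real with $b>0$. Then $g_{a,b}$ is a Bernstein function if and only if $a=1$; and for $a=1$, $g_{1,b}(y)=y/(y+b)$ is a complete Bernstein function. By the symmetry $g_{a,b}=g_{b,a}$, the symmetric statement also holds when $b\ge 1$ is an integer and $a>b-1$, $a>0$ (that is, $g_{a,b}$ is then a Bernstein function if and only if $b=1$, in which case it is a complete Bernstein function). In particular, for every integer $a\ge 2$ and every real $b>a-1$, the function $$x\longmapsto\frac{\Gamma(x)\,\Gamma(x-a+b)}{\Gamma(x-a)\,\Gamma(x+b)}=g_{a,b}(x-a)$$ is not a Bernstein function on $(a,\infty)$.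
   Context: A function $f:(0,\infty)\to[0,\infty)$ is completely monotone if $f\in C^\infty$ and $(-1)^n f^{(n)}(x)\ge 0$ for all $n\ge 0$, $x>0$. A function $g:(0,\infty)\to[0,\infty)$ is a Bernstein function if $g\in C^\infty$ and $g'$ is completely monotone; equivalently, with unique $(a_0,b_0,\nu)$, $g(x)=a_0+b_0x+\int_{(0,\infty)}(1-e^{-xt})\,\nu(dt)$, where $a_0,b_0\ge 0$ and $\nu$ is a positive measure on $(0,\infty)$ (the Lévy measure) with $\int(1\wedge t)\,\nu(dt)<\infty$. A Bernstein function is a complete Bernstein function if its Lévy measure is absolutely continuous with a completely monotone density. A function on $(a,\infty)$ is called Bernstein there if its translate $y\mapsto f(y+a)$ is a Bernstein function on $(0,\infty)$. *)

theory Defs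
  imports "HOL-Analysis.Analysis"
begin

text \<open>
  Functions on (0, \<infinity>) are total functions of type \<^typ>\<open>real \<Rightarrow> real\<close> of which only the
  values at positive arguments matter: (0, \<infinity>) is open, so the iterated derivatives at x > 0
  are determined by the restriction to (0, \<infinity>).
\<close>

text \<open>
  Differentiability of the derivatives of every order is equivalent to all of them existing and
  being continuous.
\<close>

definition smooth_on_pos :: "(real \<Rightarrow> real) \<Rightarrow> bool" where
  "smooth_on_pos f \<longleftrightarrow> (\<forall>n. (deriv ^^ n) f differentiable_on {0<..})"

definition completely_monotone :: "(real \<Rightarrow> real) \<Rightarrow> bool" where
  "completely_monotone f \<longleftrightarrow>
     (\<forall>x>0. f x \<ge> 0) \<and> smooth_on_pos f \<and>
     (\<forall>n. \<forall>x>0. (-1) ^ n * (deriv ^^ n) f x \<ge> 0)"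

definition bernstein_function :: "(real \<Rightarrow> real) \<Rightarrow> bool" where
  "bernstein_function g \<longleftrightarrow>
     (\<forall>x>0. g x \<ge> 0) \<and> smooth_on_pos g \<and> completely_monotone (deriv g)"

definition bernstein_function_from :: "real \<Rightarrow> (real \<Rightarrow> real) \<Rightarrow> bool" where
  "bernstein_function_from a f \<longleftrightarrow> bernstein_function (\<lambda>y. f (y + a))"

definition levy_triple :: "(real \<Rightarrow> real) \<Rightarrow> real \<Rightarrow> real \<Rightarrow> real measure \<Rightarrow> bool" where
  "levy_triple g a0 b0 \<nu> \<longleftrightarrow>
     a0 \<ge> 0 \<and> b0 \<ge> 0 \<and>
     space \<nu> = {0<..} \<and> sets \<nu> = sets (restrict_space borel {0<..}) \<and>
     (\<integral>\<^sup>+ t. ennreal (min 1 t) \<partial>\<nu>) < \<infinity> \<and>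
     (\<forall>x>0. g x = a0 + b0 * x + (\<integral> t. (1 - exp (- x * t)) \<partial>\<nu>))"

text \<open>
  Since the triple of a Bernstein function is unique, the existential quantifier below speaks
  about the Levy measure of g.
\<close>

definition complete_bernstein_function :: "(real \<Rightarrow> real) \<Rightarrow> bool" where
  "complete_bernstein_function g \<longleftrightarrow>
     bernstein_function g \<and>
     (\<exists>a0 b0 \<nu> m. levy_triple g a0 b0 \<nu> \<and> completely_monotone m \<and>
        \<nu> = density (restrict_space lborel {0<..}) (\<lambda>t. ennreal (m t)))"

definition gamma_ratio :: "real \<Rightarrow> real \<Rightarrow> real \<Rightarrow> real" where
  "gamma_ratio a b y = (Gamma (y + a) * Gamma (y + b)) / (Gamma y * Gamma (y + a + b))"

end

theory Submission
  imports Defs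
begin

text \<open>
  For an integer \<open>a\<close> the functional equation of Gamma turns the ratio into a rational function,
  \<open>r y = (\<Prod>j<a. (y + j) / (y + b + j))\<close>, with simple poles at \<open>- b - j\<close> and simple zeros
  at \<open>- j\<close>. Its partial fraction expansion \<open>1 + (\<Sum>k<a. c k / (y + b + k))\<close> is valid on the
  whole half-line \<open>y > - b\<close>, while the Bernstein property is a condition on \<open>y > 0\<close> only.

  The Bernstein property nevertheless controls this larger half-line. At a point \<open>z > 0\<close> the
  derivatives of order at least 1 of a Bernstein function have alternating signs, so in its expansion in powers
  of \<open>h\<close> at \<open>z - h\<close> all coefficients other than the constant one are nonpositive. For \<open>r\<close> this
  expansion is a sum of geometric series, converging for \<open>0 \<le> h < z + b\<close>; hence \<open>r\<close> is
  increasing on all of \<open>y > - b\<close> (lemma \<open>bernstein_sum_simple_fractions_mono\<close>).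

  If \<open>a \<ge> 2\<close> and \<open>b > a - 1\<close>, that half-line contains the two neighbouring zeros \<open>1 - a\<close> and
  \<open>2 - a\<close>. An increasing function vanishes between two of its zeros, but \<open>r\<close> has no zero
  strictly between them, so \<open>r\<close> is not a Bernstein function
  (lemma \<open>gamma_ratio_not_bernstein\<close>).

  If \<open>a = 1\<close>, then \<open>r y = y / (y + b) = 1 - b / (y + b)\<close>, and since \<open>1 / c\<close> is the integral of
  \<open>exp (- c * t)\<close> over \<open>t > 0\<close>, its Levy measure has the completely monotone
  density \<open>b * exp (- b * t)\<close> (lemma \<open>levy_triple_gamma_ratio_1\<close>). The case of an integer second
  parameter follows by symmetry.
\<close>

section \<open>Iterated derivatives on the positive half-line\<close>

text \<open>
  Because the positive half-line is open, iterated derivatives there can be read off from a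
  sequence of functions each of which is the derivative of its predecessor, whatever the
  function does on the rest of the line.
\<close>

lemma higher_deriv_on_pos:
  fixes g :: "real \<Rightarrow> real"
  assumes base: "\<And>x. x > 0 \<Longrightarrow> g x = F 0 x"
    and step: "\<And>n x. x > 0 \<Longrightarrow> (F n has_real_derivative F (Suc n) x) (at x)"
    and "x > 0"
  shows "(deriv ^^ n) g x = F n x"
  using \<open>x > 0\<close>
proof (induction n arbitrary: x)
  case 0
  then show ?case by (simp add: base)
next
  case (Suc n)
  have "eventually (\<lambda>y. y \<in> {0<..}) (nhds x)"
    using Suc.prems by (intro eventually_nhds_in_open) auto
  then have "eventually (\<lambda>y. (deriv ^^ n) g y = F n y) (nhds x)"
    by eventually_elim (auto intro: Suc.IH)
  then have "deriv ((deriv ^^ n) g) x = deriv (F n) x"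
    by (intro deriv_cong_ev) auto
  then show ?case
    using DERIV_imp_deriv[OF step[OF Suc.prems]] by simp
qed

lemma smooth_on_posI:
  fixes g :: "real \<Rightarrow> real"
  assumes base: "\<And>x. x > 0 \<Longrightarrow> g x = F 0 x"
    and step: "\<And>n x. x > 0 \<Longrightarrow> (F n has_real_derivative F (Suc n) x) (at x)"
  shows "smooth_on_pos g"
  unfolding smooth_on_pos_def
proof
  fix n
  have "((deriv ^^ n) g has_real_derivative F (Suc n) x) (at x)" if "x > 0" for x
    by (rule has_field_derivative_transform_within_open[OF step, of x "{0<..}"])
       (use that higher_deriv_on_pos[of g F, OF base step] in auto)
  then show "(deriv ^^ n) g differentiable_on {0<..}"
    unfolding differentiable_on_def
    by (meson differentiable_at_withinI greaterThan_iff real_differentiable_def)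
qed

lemma bernstein_function_iff:
  "bernstein_function g \<longleftrightarrow>
     (\<forall>x>0. 0 \<le> g x) \<and> smooth_on_pos g \<and>
     (\<forall>n. \<forall>x>0. 0 \<le> (- 1) ^ n * (deriv ^^ Suc n) g x)"
proof -
  have shift: "(deriv ^^ n) (deriv g) = (deriv ^^ Suc n) g" for n
    by (simp add: funpow_swap1)
  have smooth: "smooth_on_pos (deriv g)" if "smooth_on_pos g"
    using that unfolding smooth_on_pos_def shift by blast
  have pos: "0 \<le> deriv g x"
    if "\<forall>n. \<forall>x>0. 0 \<le> (- 1) ^ n * (deriv ^^ Suc n) g x" "x > 0" for x
    using that(1)[rule_format, of x 0] that(2) by simp
  show ?thesis
    unfolding bernstein_function_def completely_monotone_def shift
    using smooth pos by blast
qed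

section \<open>Sums of simple fractions\<close>

lemma has_real_derivative_sum_simple_fractions:
  fixes c p :: "'k \<Rightarrow> real"
  assumes "\<And>k. k \<in> K \<Longrightarrow> x + p k \<noteq> 0"
  shows "((\<lambda>x. (- 1) ^ n * fact n * (\<Sum>k\<in>K. c k / (x + p k) ^ Suc n)) has_real_derivative
          (- 1) ^ Suc n * fact (Suc n) * (\<Sum>k\<in>K. c k / (x + p k) ^ Suc (Suc n))) (at x)"
proof -
  have "((\<lambda>x. c k / (x + p k) ^ Suc n) has_real_derivative
         - real (Suc n) * (c k / (x + p k) ^ Suc (Suc n))) (at x)" if "k \<in> K" for k
  proof -
    note nz = assms[OF that]
    have "((\<lambda>x. c k / (x + p k) ^ Suc n) has_real_derivative
        (0 * (x + p k) ^ Suc n - c k * (real (Suc n) * (x + p k) ^ n))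
          / ((x + p k) ^ Suc n * (x + p k) ^ Suc n)) (at x)"
      using nz by (auto intro!: derivative_eq_intros simp del: power_Suc)
    also have "(0 * (x + p k) ^ Suc n - c k * (real (Suc n) * (x + p k) ^ n))
          / ((x + p k) ^ Suc n * (x + p k) ^ Suc n)
        = - real (Suc n) * (c k / (x + p k) ^ Suc (Suc n))"
      using nz by (simp add: divide_simps) (simp add: algebra_simps)
    finally show ?thesis .
  qed
  then have "((\<lambda>x. \<Sum>k\<in>K. c k / (x + p k) ^ Suc n) has_real_derivative
         (\<Sum>k\<in>K. - real (Suc n) * (c k / (x + p k) ^ Suc (Suc n)))) (at x)"
    by (intro DERIV_sum) auto
  then have "((\<lambda>x. (- 1) ^ n * fact n * (\<Sum>k\<in>K. c k / (x + p k) ^ Suc n)) has_real_derivative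
         (- 1) ^ n * fact n * (\<Sum>k\<in>K. - real (Suc n) * (c k / (x + p k) ^ Suc (Suc n)))) (at x)"
    by (rule DERIV_cmult)
  then show ?thesis
    by (simp only: sum_distrib_left[symmetric]) (simp add: algebra_simps)
qed

text \<open>
  The closed form of the iterated derivatives of \<open>x \<mapsto> C + (\<Sum>k\<in>K. c k / (x + p k))\<close>; the
  constant contributes to order 0 only.
\<close>

definition fraction_sum_deriv ::
    "real \<Rightarrow> ('k \<Rightarrow> real) \<Rightarrow> ('k \<Rightarrow> real) \<Rightarrow> 'k set \<Rightarrow> nat \<Rightarrow> real \<Rightarrow> real" where
  "fraction_sum_deriv C c p K n x =
     (if n = 0 then C else 0) + (- 1) ^ n * fact n * (\<Sum>k\<in>K. c k / (x + p k) ^ Suc n)"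

lemma fraction_sum_deriv_step:
  assumes "\<And>k. k \<in> K \<Longrightarrow> x + p k \<noteq> 0"
  shows "(fraction_sum_deriv C c p K n has_real_derivative
           fraction_sum_deriv C c p K (Suc n) x) (at x)"
proof -
  let ?S = "\<lambda>n x. (- 1) ^ n * fact n * (\<Sum>k\<in>K. c k / (x + p k) ^ Suc n)"
  have "((\<lambda>x. (if n = 0 then C else 0) + ?S n x) has_real_derivative 0 + ?S (Suc n) x) (at x)"
    by (intro DERIV_add DERIV_const has_real_derivative_sum_simple_fractions assms)
  then show ?thesis
    unfolding fraction_sum_deriv_def[abs_def] by (simp only: nat.distinct if_False)
qed

text \<open>
  By induction on the number of factors. Multiplying an expansion by the new factor
  \<open>1 + r / (x + p N)\<close>, where \<open>r = q N - p N\<close>, creates products of two simple fractions; since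
  their poles differ, each product is again a difference of simple fractions.
\<close>

lemma partial_fractions_linear_ratio:
  fixes p q :: "nat \<Rightarrow> real"
  assumes "inj_on p {..<N}"
  shows "\<exists>c. \<forall>x. (\<forall>k<N. x + p k \<noteq> 0) \<longrightarrow>
           (\<Prod>k<N. (x + q k) / (x + p k)) = 1 + (\<Sum>k<N. c k / (x + p k))"
  using assms
proof (induction N)
  case 0
  then show ?case by simp
next
  case (Suc N)
  then obtain c where c: "\<And>x. (\<forall>k<N. x + p k \<noteq> 0) \<Longrightarrow>
      (\<Prod>k<N. (x + q k) / (x + p k)) = 1 + (\<Sum>k<N. c k / (x + p k))"
    using inj_on_subset[of p "{..<Suc N}" "{..<N}"] by auto
  have dist: "p k \<noteq> p N" if "k < N" for k
    using Suc.prems that by (auto simp: inj_on_def)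
  define r where "r = q N - p N"
  \<comment> \<open>The pole of the new factor receives \<open>r\<close> itself and one contribution from each old pole.\<close>
  define d where "d k = (if k < N then c k + r * c k / (p N - p k)
      else r - (\<Sum>k<N. r * c k / (p N - p k)))" for k
  have "(\<Prod>k<Suc N. (x + q k) / (x + p k)) = 1 + (\<Sum>k<Suc N. d k / (x + p k))"
    if nz: "\<forall>k<Suc N. x + p k \<noteq> 0" for x
  proof -
    have nzN: "x + p N \<noteq> 0" using nz by simp
    have last: "(x + q N) / (x + p N) = 1 + r / (x + p N)"
      using nzN by (simp add: r_def field_simps)
    have split: "c k / (x + p k) * (r / (x + p N))
        = r * c k / (p N - p k) / (x + p k) - r * c k / (p N - p k) / (x + p N)"
      if "k < N" for k
    proof -
      have "x + p k \<noteq> 0" "p N - p k \<noteq> 0" using nz that dist[OF that] by auto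
      then show ?thesis using nzN by (simp add: divide_simps) algebra
    qed
    have "(\<Prod>k<Suc N. (x + q k) / (x + p k))
        = (1 + (\<Sum>k<N. c k / (x + p k))) * (1 + r / (x + p N))"
      using nz by (simp add: c last)
    also have "\<dots> = 1 + r / (x + p N) + (\<Sum>k<N. c k / (x + p k))
        + (\<Sum>k<N. c k / (x + p k) * (r / (x + p N)))"
      by (simp only: distrib_left distrib_right sum_distrib_right mult_1_left mult_1_right add_ac)
    also have "(\<Sum>k<N. c k / (x + p k) * (r / (x + p N)))
        = (\<Sum>k<N. r * c k / (p N - p k) / (x + p k) - r * c k / (p N - p k) / (x + p N))"
      by (intro sum.cong refl split) simp
    also have "\<dots> = (\<Sum>k<N. r * c k / (p N - p k) / (x + p k))
          - (\<Sum>k<N. r * c k / (p N - p k)) / (x + p N)"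
      by (simp only: sum_subtractf sum_divide_distrib)
    also have "1 + r / (x + p N) + (\<Sum>k<N. c k / (x + p k)) + \<dots>
        = 1 + ((\<Sum>k<N. d k / (x + p k)) + d N / (x + p N))"
      by (simp add: d_def sum.distrib add_divide_distrib diff_divide_distrib)
    finally show ?thesis by simp
  qed
  then show ?case by blast
qed

text \<open>
  Each fraction is a geometric series in \<open>h / (z + p k)\<close>. The expansion to the left of \<open>z\<close>
  converges all the way up to the nearest pole, even past the origin.
\<close>

lemma sum_simple_fractions_sums:
  fixes c p :: "'k \<Rightarrow> real"
  assumes "0 \<le> h" and "\<And>k. k \<in> K \<Longrightarrow> h < z + p k"
  shows "(\<lambda>n. (\<Sum>k\<in>K. c k / (z + p k) ^ Suc n) * h ^ n) sums (\<Sum>k\<in>K. c k / (z - h + p k))"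
proof -
  have "(\<lambda>n. c k / (z + p k) ^ Suc n * h ^ n) sums (c k / (z - h + p k))" if "k \<in> K" for k
  proof -
    have lt: "h < z + p k" using assms(2)[OF that] .
    then have "norm (h / (z + p k)) < 1" using assms(1) by simp
    from sums_mult[OF geometric_sums[OF this], of "c k / (z + p k)"]
    have "(\<lambda>n. c k / (z + p k) * (h / (z + p k)) ^ n) sums
        (c k / (z + p k) * (1 / (1 - h / (z + p k))))" .
    moreover have "c k / (z + p k) * (1 / (1 - h / (z + p k))) = c k / (z - h + p k)"
      using lt assms(1) by (simp add: divide_simps)
    moreover have "c k / (z + p k) * (h / (z + p k)) ^ n = c k / (z + p k) ^ Suc n * h ^ n" for n
      by (simp add: power_divide)
    ultimately show ?thesis by (simp only:)
  qed
  then show ?thesis unfolding sum_distrib_right by (rule sums_sum)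
qed

section \<open>The Bernstein property spreads to the left of the origin\<close>

text \<open>
  The expansion of the sum at \<open>z - h\<close> in powers of \<open>h\<close> has the coefficients
  \<open>(- 1) ^ n * (deriv ^^ n) g z / fact n\<close>, which the Bernstein property makes nonpositive
  for \<open>n \<ge> 1\<close>. So the sum decreases in \<open>h\<close>, that is, increases in the argument, on the whole interval of
  convergence.
\<close>

lemma bernstein_sum_simple_fractions_mono:
  fixes c p :: "'k \<Rightarrow> real"
  assumes bern: "bernstein_function g"
    and g: "\<And>x. x > 0 \<Longrightarrow> g x = C + (\<Sum>k\<in>K. c k / (x + p k))"
    and p: "\<And>k. k \<in> K \<Longrightarrow> b \<le> p k" and "b > 0"
  shows "mono_on {- b<..} (\<lambda>x. C + (\<Sum>k\<in>K. c k / (x + p k)))"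
proof (rule mono_onI)
  fix x y assume "x \<in> {- b<..}" "y \<in> {- b<..}" "x \<le> y"
  define z where "z = max y 1"
  have z: "z > 0" "x \<le> z" "y \<le> z" using \<open>x \<le> y\<close> by (auto simp: z_def)
  define e where "e n = (\<Sum>k\<in>K. c k / (z + p k) ^ Suc n)" for n
  have "(deriv ^^ n) g z = fraction_sum_deriv C c p K n z" for n
  proof (rule higher_deriv_on_pos[OF _ _ z(1)])
    show "g x = fraction_sum_deriv C c p K 0 x" if "x > 0" for x
      using g[OF that] by (simp add: fraction_sum_deriv_def)
    show "(fraction_sum_deriv C c p K n has_real_derivative
             fraction_sum_deriv C c p K (Suc n) x) (at x)" if "x > 0" for n x
      by (rule fraction_sum_deriv_step) (use p \<open>b > 0\<close> that in fastforce)
  qed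
  then have "0 \<le> - (fact (Suc n) * e (Suc n))" for n
    using bern z(1) unfolding bernstein_function_iff
    by (auto simp: fraction_sum_deriv_def e_def mult.assoc[symmetric] power_add[symmetric]
        simp del: funpow.simps fact_Suc power_Suc dest!: spec[of _ n] spec[of _ z])
  then have e_neg: "e (Suc n) \<le> 0" for n
    by (metis fact_gt_zero mult_pos_pos neg_0_le_iff_le not_le)
  have sums: "(\<lambda>n. e n * (z - u) ^ n) sums (\<Sum>k\<in>K. c k / (u + p k))"
    if "u \<le> z" "u > - b" for u
  proof -
    have "z - u < z + p k" if "k \<in> K" for k using p[OF that] \<open>u > - b\<close> by simp
    from sum_simple_fractions_sums[where h = "z - u" and z = z and K = K and p = p and c = c, OF _ this]
    show ?thesis
      using that by (simp add: e_def)
  qed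
  have "e n * (z - x) ^ n \<le> e n * (z - y) ^ n" for n
    using e_neg \<open>x \<le> y\<close> z
    by (cases n) (auto intro!: mult_left_mono_neg power_mono simp del: power_Suc)
  then have "(\<Sum>k\<in>K. c k / (x + p k)) \<le> (\<Sum>k\<in>K. c k / (y + p k))"
    by (rule sums_le) (use sums z \<open>x \<in> _\<close> \<open>y \<in> _\<close> in auto)
  then show "C + (\<Sum>k\<in>K. c k / (x + p k)) \<le> C + (\<Sum>k\<in>K. c k / (y + p k))" by simp
qed

section \<open>The Gamma ratio\<close>

lemma gamma_ratio_commute: "gamma_ratio a b = gamma_ratio b a"
  by (rule ext) (simp add: gamma_ratio_def algebra_simps)

lemma gamma_ratio_eq_pochhammer:
  assumes "y > 0" "b > 0"
  shows "gamma_ratio (real a) b y = pochhammer y a / pochhammer (y + b) a"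
proof -
  have "Gamma y > 0" "Gamma (y + b) > 0" "Gamma (y + b + real a) > 0"
    using assms by (auto intro!: Gamma_real_pos)
  moreover have "y \<notin> \<int>\<^sub>\<le>\<^sub>0" "y + b \<notin> \<int>\<^sub>\<le>\<^sub>0"
    using assms by (auto elim!: nonpos_Ints_cases)
  ultimately show ?thesis
    by (simp add: pochhammer_Gamma gamma_ratio_def add_ac mult_ac)
qed

text \<open>
  The condition on \<open>b\<close> says exactly that the zero \<open>1 - a\<close> lies to the right of every pole, so
  that monotonicity forces the ratio to vanish between this zero and the next one, \<open>2 - a\<close>.
\<close>

lemma gamma_ratio_not_bernstein:
  assumes "a \<ge> 2" and b: "b > real a - 1"
  shows "\<not> bernstein_function (gamma_ratio (real a) b)"
proof
  assume bern: "bernstein_function (gamma_ratio (real a) b)"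
  have "b > 0" using assms by simp
  define r where "r x = pochhammer x a / pochhammer (x + b) a" for x :: real
  obtain c where c: "\<And>x. \<forall>k<a. x + (b + real k) \<noteq> 0 \<Longrightarrow>
      (\<Prod>k<a. (x + real k) / (x + (b + real k))) = 1 + (\<Sum>k<a. c k / (x + (b + real k)))"
    using partial_fractions_linear_ratio[of "\<lambda>k. b + real k" a real] by (auto simp: inj_on_def)
  have r: "r x = 1 + (\<Sum>k<a. c k / (x + (b + real k)))" if "x > - b" for x
  proof -
    have "r x = (\<Prod>k<a. (x + real k) / (x + (b + real k)))"
      by (simp add: r_def pochhammer_prod prod_dividef atLeast0LessThan add_ac)
    also have "\<dots> = 1 + (\<Sum>k<a. c k / (x + (b + real k)))"
      by (rule c) (use that in fastforce)
    finally show ?thesis .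
  qed
  have "mono_on {- b<..} (\<lambda>x. 1 + (\<Sum>k\<in>{..<a}. c k / (x + (b + real k))))"
    using bern
  proof (rule bernstein_sum_simple_fractions_mono)
    show "gamma_ratio (real a) b x = 1 + (\<Sum>k<a. c k / (x + (b + real k)))" if "x > 0" for x
      using gamma_ratio_eq_pochhammer[OF that \<open>b > 0\<close>] r[of x] that \<open>b > 0\<close> by (simp add: r_def)
  qed (use \<open>b > 0\<close> in auto)
  then have mono: "r x \<le> r y" if "- b < x" "x \<le> y" for x y
    using that r by (auto simp: mono_on_def)
  have zero: "r x = 0 \<longleftrightarrow> (\<exists>k<a. x = - real k)" if "x > - b" for x
  proof -
    have "pochhammer (x + b) a > 0" using that by (intro pochhammer_pos) auto
    then have "r x = 0 \<longleftrightarrow> pochhammer x a = 0" by (simp add: r_def)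
    then show ?thesis by (simp only: pochhammer_eq_0_iff)
  qed
  have "r (1 - real a) = 0"
    by (intro zero[THEN iffD2] exI[of _ "a - 1"]) (use \<open>a \<ge> 2\<close> b in \<open>auto simp: of_nat_diff\<close>)
  moreover have "r (2 - real a) = 0"
    by (intro zero[THEN iffD2] exI[of _ "a - 2"]) (use \<open>a \<ge> 2\<close> b in \<open>auto simp: of_nat_diff\<close>)
  \<comment> \<open>The midpoint is squeezed between the two zeros, yet it is not an integer.\<close>
  ultimately have "r (3 / 2 - real a) = 0"
    using mono[of "1 - real a" "3 / 2 - real a"] mono[of "3 / 2 - real a" "2 - real a"] b by simp
  then obtain k where "3 / 2 - real a = - real k"
    using zero[of "3 / 2 - real a"] b by auto
  then have "real (2 * a) = real (2 * k + 3)" by simp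
  then have "2 * a = 2 * k + 3" by (simp only: of_nat_eq_iff)
  then show False by presburger
qed

section \<open>The complete Bernstein case\<close>

lemma gamma_ratio_1:
  assumes "y > 0" "b > 0"
  shows "gamma_ratio 1 b y = y / (y + b)"
  using gamma_ratio_eq_pochhammer[OF assms, of 1] by simp

lemma bernstein_function_gamma_ratio_1:
  assumes "b > 0"
  shows "bernstein_function (gamma_ratio 1 b)"
proof -
  \<comment> \<open>\<open>x / (x + b) = 1 - b / (x + b)\<close>, a sum of simple fractions over a one-element set.\<close>
  define F where "F = fraction_sum_deriv 1 (\<lambda>_. - b) (\<lambda>_. b) {()}"
  have base: "gamma_ratio 1 b x = F 0 x" if "x > 0" for x
    using gamma_ratio_1[OF that assms] that assms
    by (simp add: F_def fraction_sum_deriv_def field_simps)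
  have step: "(F n has_real_derivative F (Suc n) x) (at x)" if "x > 0" for n x
    unfolding F_def using that assms by (intro fraction_sum_deriv_step) auto
  have "0 \<le> (- 1) ^ n * (deriv ^^ Suc n) (gamma_ratio 1 b) x" if "x > 0" for n x
  proof -
    have "(- 1) ^ n * F (Suc n) x = fact (Suc n) * (b / (x + b) ^ Suc (Suc n))"
      by (simp add: F_def fraction_sum_deriv_def mult.assoc[symmetric] power_add[symmetric]
          del: fact_Suc)
    also have "\<dots> \<ge> 0" using that assms by simp
    finally show ?thesis
      using higher_deriv_on_pos[of "gamma_ratio 1 b" F x "Suc n", OF base step that] by simp
  qed
  then show ?thesis
    unfolding bernstein_function_iff
    using smooth_on_posI[of "gamma_ratio 1 b" F, OF base step] gamma_ratio_1 assms by simp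
qed

lemma completely_monotone_exp:
  assumes "b > 0"
  shows "completely_monotone (\<lambda>t. b * exp (- b * t))"
proof -
  let ?F = "\<lambda>n t. b * (- b) ^ n * exp (- b * t)"
  have base: "b * exp (- b * x) = ?F 0 x" for x by simp
  have step: "(?F n has_real_derivative ?F (Suc n) x) (at x)" for n x
    by (auto intro!: derivative_eq_intros)
  have "0 \<le> (- 1) ^ n * (deriv ^^ n) (\<lambda>t. b * exp (- b * t)) x" if "x > 0" for n x
  proof -
    have "(deriv ^^ n) (\<lambda>t. b * exp (- b * t)) x = ?F n x"
      using that by (intro higher_deriv_on_pos[where F = ?F] base step)
    then have "(- 1) ^ n * (deriv ^^ n) (\<lambda>t. b * exp (- b * t)) x = (- 1) ^ n * ?F n x"
      by (rule arg_cong)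
    also have "\<dots> = b * b ^ n * exp (- b * x)"
      by (simp add: mult_ac power_mult_distrib[symmetric])
    also have "\<dots> \<ge> 0" using assms by simp
    finally show ?thesis .
  qed
  moreover have "smooth_on_pos (\<lambda>t. b * exp (- b * t))"
    by (intro smooth_on_posI[where F = ?F] base step)
  ultimately show ?thesis
    unfolding completely_monotone_def using assms by (intro conjI allI impI) simp_all
qed

lemma has_bochner_integral_exp_pos:
  fixes c :: real
  assumes "c > 0"
  shows "has_bochner_integral (restrict_space lborel {0<..}) (\<lambda>t. exp (- c * t)) (1 / c)"
proof -
  have "((\<lambda>t. exp (- c * t)) has_integral 1 / c) {0..}"
    using has_integral_exp_minus_to_infinity[OF assms, of 0] by simp
  then have "((\<lambda>t. exp (- c * t)) has_integral 1 / c) {0<..}"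
    by (rule has_integral_spike_set_eq[THEN iffD1, rotated 2])
       (auto intro!: negligible_subset[OF negligible_sing[of 0]])
  from nn_integral_has_integral_lebesgue'[OF _ this]
  have "(\<integral>\<^sup>+ t. ennreal (exp (- c * t)) \<partial>restrict_space lborel {0<..}) = ennreal (1 / c)"
    by (simp add: nn_integral_restrict_space)
  then show ?thesis
    using assms
    by (intro has_bochner_integral_nn_integral)
       (auto intro!: measurable_restrict_space1 borel_measurable_continuous_onI continuous_intros)
qed

text \<open>
  Against the density, \<open>1 - exp (- x * t)\<close> integrates to \<open>b * (1 / b) - b * (1 / (x + b))\<close>. The
  density has total mass 1, which bounds the integral of \<open>min 1 t\<close>.
\<close>

lemma levy_triple_gamma_ratio_1:
  assumes "b > 0"
  shows "levy_triple (gamma_ratio 1 b) 0 0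
           (density (restrict_space lborel {0<..}) (\<lambda>t. ennreal (b * exp (- b * t))))"
    (is "levy_triple _ _ _ (density ?M _)")
proof -
  have meas: "f \<in> borel_measurable ?M" if "f \<in> borel_measurable borel" for f :: "real \<Rightarrow> 'x::topological_space"
    using that by (intro measurable_restrict_space1) simp
  have "(\<integral>\<^sup>+ t. ennreal (min 1 t) \<partial>density ?M (\<lambda>t. ennreal (b * exp (- b * t))))
      = (\<integral>\<^sup>+ t. ennreal (b * exp (- b * t)) * ennreal (min 1 t) \<partial>?M)"
    by (intro nn_integral_density meas) measurable
  also have "\<dots> \<le> (\<integral>\<^sup>+ t. ennreal (b * exp (- b * t)) \<partial>?M)"
    by (intro nn_integral_mono mult_left_le) auto
  also have "\<dots> < \<infinity>"
  proof -
    have "integrable ?M (\<lambda>t. b * exp (- b * t))"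
      using has_bochner_integral_exp_pos[OF assms] by (auto simp: has_bochner_integral_iff)
    then show ?thesis using assms by (simp add: nn_integral_eq_integral)
  qed
  finally have fin: "(\<integral>\<^sup>+ t. ennreal (min 1 t)
      \<partial>density ?M (\<lambda>t. ennreal (b * exp (- b * t)))) < \<infinity>" .
  have val: "gamma_ratio 1 b x = (\<integral> t. (1 - exp (- x * t))
      \<partial>density ?M (\<lambda>t. ennreal (b * exp (- b * t))))" if "x > 0" for x
  proof -
    have I: "integrable ?M (\<lambda>t. exp (- b * t))" "integral\<^sup>L ?M (\<lambda>t. exp (- b * t)) = 1 / b"
      "integrable ?M (\<lambda>t. exp (- (x + b) * t))"
      "integral\<^sup>L ?M (\<lambda>t. exp (- (x + b) * t)) = 1 / (x + b)"
      using has_bochner_integral_exp_pos[of b] has_bochner_integral_exp_pos[of "x + b"] assms that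
      by (auto simp: has_bochner_integral_iff)
    have "(\<integral> t. (1 - exp (- x * t)) \<partial>density ?M (\<lambda>t. ennreal (b * exp (- b * t))))
        = (\<integral> t. (b * exp (- b * t)) *\<^sub>R (1 - exp (- x * t)) \<partial>?M)"
      using assms by (intro integral_density meas AE_I2) auto
    also have "(\<lambda>t. (b * exp (- b * t)) *\<^sub>R (1 - exp (- x * t)))
        = (\<lambda>t. b * exp (- b * t) - b * exp (- (x + b) * t))"
      by (simp add: fun_eq_iff algebra_simps exp_add[symmetric])
    also have "integral\<^sup>L ?M \<dots> = b * (1 / b) - b * (1 / (x + b))"
      using I by simp
    also have "\<dots> = gamma_ratio 1 b x"
      using gamma_ratio_1[OF that assms] that assms by (simp add: field_simps)
    finally show ?thesis by simp
  qed
  show ?thesis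
    unfolding levy_triple_def using fin val
    by (auto simp: space_restrict_space sets_restrict_space)
qed

lemma complete_bernstein_gamma_ratio_1:
  assumes "b > 0"
  shows "complete_bernstein_function (gamma_ratio 1 b)"
  unfolding complete_bernstein_function_def
  using bernstein_function_gamma_ratio_1[OF assms] levy_triple_gamma_ratio_1[OF assms]
    completely_monotone_exp[OF assms] by blast

lemma bernstein_function_gamma_ratio_iff:
  assumes "a \<ge> 1" "b > real a - 1" "b > 0"
  shows "bernstein_function (gamma_ratio (real a) b) \<longleftrightarrow> a = 1"
  using gamma_ratio_not_bernstein[of a b] bernstein_function_gamma_ratio_1[of b] assms
  by (cases "a = 1") auto

theorem theorem4p2:
  shows
    "(\<forall>a b y :: real. a > 0 \<and> b > 0 \<and> y > 0 \<longrightarrow> gamma_ratio a b y = gamma_ratio b a y) \<and>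
     (\<forall>(a::nat) (b::real). a \<ge> 1 \<and> b > real a - 1 \<and> b > 0 \<longrightarrow>
        (bernstein_function (gamma_ratio (real a) b) \<longleftrightarrow> a = 1)) \<and>
     (\<forall>b::real. b > 0 \<longrightarrow>
        (\<forall>y>0. gamma_ratio 1 b y = y / (y + b)) \<and>
        complete_bernstein_function (gamma_ratio 1 b)) \<and>
     (\<forall>(a::real) (b::nat). b \<ge> 1 \<and> a > real b - 1 \<and> a > 0 \<longrightarrow>
        (bernstein_function (gamma_ratio a (real b)) \<longleftrightarrow> b = 1) \<and>
        (b = 1 \<longrightarrow> complete_bernstein_function (gamma_ratio a (real b)))) \<and>
     (\<forall>(a::nat) (b::real). a \<ge> 2 \<and> b > real a - 1 \<longrightarrow>
        (\<forall>x > real a.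
           (Gamma x * Gamma (x - real a + b)) / (Gamma (x - real a) * Gamma (x + b))
             = gamma_ratio (real a) b (x - real a)) \<and>
        \<not> bernstein_function_from (real a)
            (\<lambda>x. (Gamma x * Gamma (x - real a + b)) / (Gamma (x - real a) * Gamma (x + b))))"
proof (intro conjI allI impI)
  fix a b y :: real
  show "gamma_ratio a b y = gamma_ratio b a y" by (simp add: gamma_ratio_commute)
next
  fix a :: nat and b :: real assume "a \<ge> 1 \<and> b > real a - 1 \<and> b > 0"
  then show "bernstein_function (gamma_ratio (real a) b) \<longleftrightarrow> a = 1"
    using bernstein_function_gamma_ratio_iff by blast
next
  fix b y :: real assume "b > 0" "y > 0"
  then show "gamma_ratio 1 b y = y / (y + b)" by (simp add: gamma_ratio_1)
next
  fix b :: real assume "b > 0"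
  then show "complete_bernstein_function (gamma_ratio 1 b)"
    by (rule complete_bernstein_gamma_ratio_1)
next
  fix a :: real and b :: nat assume "b \<ge> 1 \<and> a > real b - 1 \<and> a > 0"
  then show "bernstein_function (gamma_ratio a (real b)) \<longleftrightarrow> b = 1"
    using bernstein_function_gamma_ratio_iff[of b a] by (simp add: gamma_ratio_commute[of a])
next
  fix a :: real and b :: nat assume "b \<ge> 1 \<and> a > real b - 1 \<and> a > 0" "b = 1"
  then show "complete_bernstein_function (gamma_ratio a (real b))"
    using complete_bernstein_gamma_ratio_1[of a] by (simp add: gamma_ratio_commute[of a])
next
  fix a :: nat and b x :: real
  show "(Gamma x * Gamma (x - real a + b)) / (Gamma (x - real a) * Gamma (x + b))
      = gamma_ratio (real a) b (x - real a)"
    by (simp add: gamma_ratio_def)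
next
  fix a :: nat and b :: real assume "a \<ge> 2 \<and> b > real a - 1"
  moreover have "(\<lambda>y. (Gamma (y + real a) * Gamma (y + real a - real a + b))
        / (Gamma (y + real a - real a) * Gamma (y + real a + b))) = gamma_ratio (real a) b"
    by (simp add: fun_eq_iff gamma_ratio_def)
  ultimately show "\<not> bernstein_function_from (real a)
      (\<lambda>x. (Gamma x * Gamma (x - real a + b)) / (Gamma (x - real a) * Gamma (x + b)))"
    unfolding bernstein_function_from_def using gamma_ratio_not_bernstein by simp
qed

end
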